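(* The ordinary generating function $F(z)=\sum_{n\ge0}\alpha_n z^n$ of the pseudo-factorials satisfies, in the sense of formal power series, $$F(z)=\cfrac{1}{1+z+\cfrac{3\cdot 1^2\cdot z^2}{1-z+\cfrac{2^2\cdot z^2}{1+3z+\cfrac{3\cdot 3^2\cdot z^2}{1-3z+\cfrac{4^2\cdot z^2}{\ddots}}}}},$$ that is, $$F(z)=\cfrac{1}{1-c_0z-\cfrac{a_1z^2}{1-c_1z-\cfrac{a_2z^2}{\ddots}}}$$ with coefficients $$c_j=(-1)^{j-1}\left(j+\frac{1+(-1)^j}{2}\right)\quad(j\ge0),\qquad a_j=-j^2\left(2-(-1)^j\right)\quad(j\ge1).$$
   Context: The pseudo-factorials $(\alpha_n)_{n\ge 0}$ are the integers defined by $\alpha_0=1$ and $\alpha_{n+1}=(-1)^{n+1}\sum_{k=0}^n\binom{n}{k}\alpha_k\alpha_{n-k}$ for $n\ge 0$. The infinite continued fraction is understood as the limit, in the $z$-adic topology on formal power series, of the convergents obtained by truncating before a numerator ($0/1$, $1/(1-c_0z)$, etc.). *)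

theory Defs
  imports "HOL-Computational_Algebra.Formal_Power_Series"
begin

function pseudo_factorial :: "nat \<Rightarrow> int" where
  "pseudo_factorial 0 = 1"
| "pseudo_factorial (Suc n) =
     (-1) ^ (n + 1) * (\<Sum>k\<le>n. int (n choose k) * pseudo_factorial k * pseudo_factorial (n - k))"
  by pat_completeness auto
termination
  by (relation "measure id") auto

text \<open>
  \<open>jfrac_from c a j m\<close> consists of the \<open>m\<close> levels \<open>j, \<dots>, j + m - 1\<close> of the Jacobi-type
  continued fraction with coefficients \<open>c\<close> and \<open>a\<close>,
  \<open>1/(1 - c\<^sub>j z - a\<^sub>j\<^sub>+\<^sub>1 z\<^sup>2/(1 - c\<^sub>j\<^sub>+\<^sub>1 z - \<dots>))\<close>, where the numerator of the next
  level is replaced by 0. All denominators have constant term 1, hence are invertible.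
\<close>
primrec jfrac_from ::
  "(nat \<Rightarrow> 'a::field) \<Rightarrow> (nat \<Rightarrow> 'a) \<Rightarrow> nat \<Rightarrow> nat \<Rightarrow> 'a fps" where
  "jfrac_from c a j 0 = 0"
| "jfrac_from c a j (Suc m) =
     1 / (1 - fps_const (c j) * fps_X
            - fps_const (a (Suc j)) * fps_X ^ 2 * jfrac_from c a (Suc j) m)"

definition jfrac_convergent :: "(nat \<Rightarrow> 'a::field) \<Rightarrow> (nat \<Rightarrow> 'a) \<Rightarrow> nat \<Rightarrow> 'a fps" where
  "jfrac_convergent c a m = jfrac_from c a 0 m"

text \<open>
  The topology on \<^typ>\<open>'a fps\<close> is the one induced by the metric
  \<open>dist f g = inverse (2 ^ subdegree (f - g))\<close> for \<open>f \<noteq> g\<close>, i.e. the \<open>z\<close>-adic topology.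
\<close>
definition has_jfrac :: "'a::field fps \<Rightarrow> (nat \<Rightarrow> 'a) \<Rightarrow> (nat \<Rightarrow> 'a) \<Rightarrow> bool" where
  "has_jfrac F c a \<longleftrightarrow> jfrac_convergent c a \<longlonglongrightarrow> F"

definition pf_ogf :: "rat fps" where
  "pf_ogf = Abs_fps (\<lambda>n. of_int (pseudo_factorial n))"

text \<open>The exponent \<open>j - 1\<close> equals \<open>-1\<close> for \<open>j = 0\<close>, hence the integer power.\<close>
definition pf_c :: "nat \<Rightarrow> rat" where
  "pf_c j = (-1) powi (int j - 1) * (of_nat j + (1 + (-1) ^ j) / 2)"

definition pf_a :: "nat \<Rightarrow> rat" where
  "pf_a j = - (of_nat j ^ 2) * (2 - (-1) ^ j)"

text \<open>
  Hence the partial denominators \<open>1 - c\<^sub>j z\<close> are \<open>1 + z, 1 - z, 1 + 3z, 1 - 3z, \<dots>\<close> and the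
  numerators \<open>-a\<^sub>j z\<^sup>2\<close> are \<open>3\<cdot>1\<^sup>2 z\<^sup>2, 2\<^sup>2 z\<^sup>2, 3\<cdot>3\<^sup>2 z\<^sup>2, 4\<^sup>2 z\<^sup>2, \<dots>\<close>.
\<close>
lemma pf_c_parity: "pf_c j = (if even j then - of_nat (j + 1) else of_nat j)"
  by (auto simp: pf_c_def power_int_diff)

lemma pf_a_parity: "pf_a j = (if even j then - (of_nat j ^ 2) else - 3 * of_nat j ^ 2)"
  by (auto simp: pf_a_def)

end

theory Submission
  imports Defs
begin

text \<open>
  Let \<open>f\<close> be the exponential generating function of the pseudo-factorials and \<open>g(x) = f(-x)\<close>.
  The recurrence says \<open>f' = -g\<^sup>2\<close>, hence \<open>g' = f\<^sup>2\<close>, and so \<open>f\<^sup>3 + g\<^sup>3\<close> is constant, with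
  value 2 (\<open>pf_egf_cubes\<close>): up to scaling and translation, \<open>f\<close> and \<open>g\<close> are the Dixonian
  elliptic functions, which parametrise the Fermat cubic.

  Put \<open>u = 1 - f g\<close> and \<open>v = g\<^sup>2 - f\<close>. Reducing modulo the cubic, one finds that the derivatives
  \<open>(f u\<^sup>k)'\<close> and \<open>(v u\<^sup>k)'\<close> are linear combinations of neighbours in the sequence
  \<open>f, v, f u, v u, f u\<^sup>2, v u\<^sup>2, \<dots>\<close>:
  \<open>\<phi>\<^sub>j' = b\<^sub>j \<phi>\<^sub>j\<^sub>-\<^sub>1 + c\<^sub>j \<phi>\<^sub>j + d\<^sub>j\<^sub>+\<^sub>1 \<phi>\<^sub>j\<^sub>+\<^sub>1\<close>, with the \<open>c\<^sub>j\<close> of the theorem and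
  with \<open>b\<^sub>j d\<^sub>j = a\<^sub>j\<close> (\<open>deriv_pf_ladder\<close>). Moreover \<open>u\<close> and \<open>v\<close> vanish at 0, so
  that \<open>\<phi>\<^sub>j(0) = 0\<close> for all \<open>j > 0\<close>.

  Any such tridiagonal system of differential equations yields a Jacobi continued fraction
  (\<open>has_jfrac_of_tridiagonal_system\<close>). The formal Laplace transform \<open>x\<^sup>n / n! \<mapsto> z\<^sup>n\<close>
  turns it into the linear system
  \<open>(1 - c\<^sub>j z) L\<^sub>j = b\<^sub>j z L\<^sub>j\<^sub>-\<^sub>1 + d\<^sub>j\<^sub>+\<^sub>1 z L\<^sub>j\<^sub>+\<^sub>1\<close> for \<open>j > 0\<close>,
  so the quotients \<open>L\<^sub>j / (b\<^sub>j z L\<^sub>j\<^sub>-\<^sub>1)\<close> unroll into the tails of the continued fraction;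
  for \<open>j = 0\<close> the initial value 1 takes the place of \<open>b\<^sub>j z L\<^sub>j\<^sub>-\<^sub>1\<close>, and \<open>L\<^sub>0\<close> is the ordinary
  generating function.
\<close>

section \<open>The formal Laplace transform\<close>

definition fps_laplace :: "'a::{comm_ring_1, ring_char_0} fps \<Rightarrow> 'a fps" where
  "fps_laplace \<phi> = Abs_fps (\<lambda>n. fact n * fps_nth \<phi> n)"

lemma fps_laplace_add: "fps_laplace (\<phi> + \<psi>) = fps_laplace \<phi> + fps_laplace \<psi>"
  by (simp add: fps_laplace_def fps_eq_iff algebra_simps)

lemma fps_laplace_const_mult:
  "fps_laplace (fps_const r * \<phi>) = fps_const r * fps_laplace \<phi>"
  by (simp add: fps_laplace_def fps_eq_iff algebra_simps)

text \<open>
  Integration by parts: differentiation becomes division by the variable, up to the initial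
  value. This is what turns differential equations into linear ones.
\<close>
lemma fps_laplace_eq_deriv:
  "fps_laplace \<phi> = fps_const (fps_nth \<phi> 0) + fps_X * fps_laplace (fps_deriv \<phi>)"
proof (rule fps_ext)
  fix n
  show "fps_nth (fps_laplace \<phi>) n =
    fps_nth (fps_const (fps_nth \<phi> 0) + fps_X * fps_laplace (fps_deriv \<phi>)) n"
    by (cases n) (simp_all add: fps_laplace_def algebra_simps)
qed

section \<open>Continued fractions from tridiagonal systems\<close>

lemma has_jfracI:
  fixes F :: "'a::field fps"
  assumes "\<And>m. fps_X ^ m dvd F - jfrac_convergent c a m"
  shows "has_jfrac F c a"
  unfolding has_jfrac_def
proof (rule tendsto_fpsI)
  fix n
  have "fps_nth (jfrac_convergent c a m) n = fps_nth F n" if "n < m" for m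
  proof -
    from assms[of m] obtain R where "F - jfrac_convergent c a m = fps_X ^ m * R"
      by (elim dvdE)
    then have "fps_nth (F - jfrac_convergent c a m) n = 0"
      using that by (simp add: fps_X_power_mult_nth)
    then show ?thesis
      by simp
  qed
  then show "\<forall>\<^sub>F m in sequentially. fps_nth (jfrac_convergent c a m) n = fps_nth F n"
    by (rule eventually_mono[OF eventually_gt_at_top[of n]])
qed

text \<open>
  The three-term relation between the Laplace transforms \<open>L\<^sub>j\<close> makes \<open>L\<^sub>j / N\<^sub>j\<close> satisfy the
  recursion of the continued fraction tails, where \<open>N\<^sub>j\<close> is \<open>b\<^sub>j z L\<^sub>j\<^sub>-\<^sub>1\<close>, or 1 for \<open>j = 0\<close>.
  The proof compares \<open>L\<^sub>j\<close> with \<open>N\<^sub>j\<close> times a finite tail, so that no \<open>L\<^sub>j\<close> has to be nonzero.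
  Each further level multiplies the error at \<open>j + 1\<close> by \<open>z\<close>, and the levels start from the
  error \<open>L\<^sub>j = O(z\<^sup>j)\<close>; together this gives the order \<open>2 m + j\<close>.

  The hypothesis \<open>b 0 = 0\<close> disposes of the term \<open>\<phi> (0 - 1)\<close>, which is \<open>\<phi> 0\<close> by truncated
  subtraction. Scaling the \<open>\<phi> j\<close> changes \<open>b\<close> and \<open>d\<close> but not the products \<open>b\<^sub>j d\<^sub>j\<close>.
\<close>
lemma has_jfrac_of_tridiagonal_system:
  fixes \<phi> :: "nat \<Rightarrow> 'a::field_char_0 fps"
  assumes init: "\<And>j. fps_nth (\<phi> j) 0 = (if j = 0 then 1 else 0)"
  assumes deriv: "\<And>j. fps_deriv (\<phi> j) =
      fps_const (b j) * \<phi> (j - 1) + fps_const (c j) * \<phi> j + fps_const (d (Suc j)) * \<phi> (Suc j)"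
  assumes b0: "b 0 = 0"
  assumes a: "\<And>j. a (Suc j) = b (Suc j) * d (Suc j)"
  shows "has_jfrac (fps_laplace (\<phi> 0)) c a"
proof -
  define L where "L j = fps_laplace (\<phi> j)" for j
  define N where "N j = fps_const (fps_nth (\<phi> j) 0) + fps_const (b j) * fps_X * L (j - 1)" for j
  have N_0: "N 0 = 1" and N_Suc: "N (Suc j) = fps_const (b (Suc j)) * fps_X * L j" for j
    by (simp_all add: N_def init b0)
  have L_eq: "L j = N j + fps_X * (fps_const (c j) * L j + fps_const (d (Suc j)) * L (Suc j))" for j
    unfolding L_def N_def
    by (subst fps_laplace_eq_deriv, subst deriv)
       (simp only: fps_laplace_add fps_laplace_const_mult, simp add: algebra_simps)
  \<comment> \<open>Every term on the right of the system for \<open>j > 0\<close> carries a factor \<open>z\<close>.\<close>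
  have order: "fps_X ^ n dvd L j" if "n \<le> j" for n j
    using that
  proof (induction n arbitrary: j)
    case (Suc n)
    then obtain i where j: "j = Suc i" and "n \<le> i"
      by (cases j) auto
    then have "fps_X ^ n dvd L i" "fps_X ^ n dvd L (Suc i)" "fps_X ^ n dvd L (Suc (Suc i))"
      by (auto intro!: Suc.IH)
    then have "fps_X * fps_X ^ n dvd fps_X * (fps_const (b (Suc i)) * L i
        + fps_const (c (Suc i)) * L (Suc i) + fps_const (d (Suc (Suc i))) * L (Suc (Suc i)))"
      by (intro mult_dvd_mono dvd_refl dvd_add dvd_mult)
    moreover have "\<dots> = L j"
      unfolding j by (subst (4) L_eq) (simp add: N_Suc algebra_simps)
    ultimately show ?case
      by simp
  qed simp
  have approx: "fps_X ^ (2 * m + j) dvd L j - N j * jfrac_from c a j m" for j m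
  proof (induction m arbitrary: j)
    case 0
    then show ?case
      by (simp add: order)
  next
    case (Suc m)
    define G where "G = jfrac_from c a (Suc j) m"
    define D where "D = 1 - fps_const (c j) * fps_X - fps_const (a (Suc j)) * fps_X ^ 2 * G"
    have "fps_nth D 0 = 1"
      by (simp add: D_def power2_eq_square mult.assoc)
    then have unit: "inverse D * D = 1"
      by (simp add: inverse_mult_eq_1)
    have G_Suc: "jfrac_from c a j (Suc m) = inverse D"
      using \<open>fps_nth D 0 = 1\<close> by (simp add: D_def G_def fps_divide_unit)
    have "L j * D - N j = fps_const (d (Suc j)) * (fps_X * (L (Suc j) - N (Suc j) * G))"
    proof -
      have "N j = L j - fps_X * (fps_const (c j) * L j + fps_const (d (Suc j)) * L (Suc j))"
        using L_eq[of j] by (simp add: algebra_simps)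
      moreover have "fps_const (a (Suc j)) = fps_const (b (Suc j)) * fps_const (d (Suc j))"
        by (simp add: a)
      ultimately show ?thesis
        unfolding D_def N_Suc by (simp add: algebra_simps power2_eq_square del: fps_const_mult)
    qed
    moreover have "fps_X * fps_X ^ (2 * m + Suc j) dvd fps_X * (L (Suc j) - N (Suc j) * G)"
      unfolding G_def by (intro mult_dvd_mono dvd_refl Suc.IH)
    ultimately have "fps_X ^ (2 * Suc m + j) dvd L j * D - N j"
      by simp
    then have "fps_X ^ (2 * Suc m + j) dvd inverse D * (L j * D - N j)"
      by (rule dvd_mult)
    also have "inverse D * (L j * D - N j) = L j * (inverse D * D) - N j * inverse D"
      by (simp add: algebra_simps)
    finally show ?case
      unfolding unit G_Suc by simp
  qed
  show ?thesis
  proof (rule has_jfracI)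
    fix m
    have "(fps_X :: 'a fps) ^ m dvd fps_X ^ (2 * m)"
      by (rule le_imp_power_dvd) simp
    also have "\<dots> dvd fps_laplace (\<phi> 0) - jfrac_convergent c a m"
      using approx[of m 0] by (simp add: N_0 L_def jfrac_convergent_def)
    finally show "fps_X ^ m dvd fps_laplace (\<phi> 0) - jfrac_convergent c a m" .
  qed
qed

section \<open>The differential system of the pseudo-factorials\<close>

definition pf_egf :: "rat fps" where
  "pf_egf = Abs_fps (\<lambda>n. of_int (pseudo_factorial n) / fact n)"

definition pf_egf_reflected :: "rat fps" where
  "pf_egf_reflected = Abs_fps (\<lambda>n. (-1) ^ n * fps_nth pf_egf n)"

lemma pf_egf_square_nth:
  "fps_nth (pf_egf ^ 2) n = (-1) ^ (n + 1) * of_int (pseudo_factorial (Suc n)) / fact n"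
proof -
  have "fps_nth (pf_egf ^ 2) n =
      (\<Sum>k\<le>n. of_nat (n choose k) * of_int (pseudo_factorial k)
        * of_int (pseudo_factorial (n - k)) / fact n)"
    unfolding power2_eq_square fps_mult_nth atLeast0AtMost
    by (intro sum.cong) (simp_all add: pf_egf_def binomial_fact)
  also have "\<dots> = (-1) ^ (n + 1) * of_int (pseudo_factorial (Suc n)) / fact n"
    by (simp add: sum_divide_distrib[symmetric] flip: mult.assoc power_mult_distrib)
  finally show ?thesis .
qed

lemma pf_egf_reflected_square_nth:
  "fps_nth (pf_egf_reflected ^ 2) n = (-1) ^ n * fps_nth (pf_egf ^ 2) n"
  unfolding power2_eq_square fps_mult_nth sum_distrib_left
  by (intro sum.cong) (auto simp: pf_egf_reflected_def simp flip: power_add)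

lemma deriv_pf_egf: "fps_deriv pf_egf = - (pf_egf_reflected ^ 2)"
  by (rule fps_ext, simp only: fps_neg_nth pf_egf_reflected_square_nth pf_egf_square_nth)
     (simp add: pf_egf_def flip: mult.assoc power_mult_distrib)

lemma deriv_pf_egf_reflected: "fps_deriv pf_egf_reflected = pf_egf ^ 2"
  by (rule fps_ext, simp only: pf_egf_square_nth)
     (simp add: pf_egf_reflected_def pf_egf_def)

lemma pf_egf_nth_0: "fps_nth pf_egf 0 = 1" "fps_nth pf_egf_reflected 0 = 1"
  by (simp_all add: pf_egf_def pf_egf_reflected_def)

text \<open>
  The first integral of the system \<open>f' = -g\<^sup>2\<close>, \<open>g' = f\<^sup>2\<close>.
\<close>
lemma pf_egf_cubes: "pf_egf ^ 3 + pf_egf_reflected ^ 3 = 2"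
proof -
  have "fps_deriv (pf_egf ^ 3 + pf_egf_reflected ^ 3) = 0"
    by (simp add: fps_deriv_power' deriv_pf_egf deriv_pf_egf_reflected)
  then have "pf_egf ^ 3 + pf_egf_reflected ^ 3
      = fps_const (fps_nth (pf_egf ^ 3 + pf_egf_reflected ^ 3) 0)"
    by (simp only: fps_deriv_eq_0_iff)
  then show ?thesis
    by (simp add: pf_egf_nth_0 fps_power_zeroth numeral_fps_const)
qed

lemma pf_ogf_eq_laplace: "pf_ogf = fps_laplace pf_egf"
  by (simp add: pf_ogf_def fps_laplace_def pf_egf_def)

section \<open>The tridiagonal system\<close>

text \<open>
  The sequence \<open>f, v, f u, v u, f u\<^sup>2, v u\<^sup>2, \<dots>\<close>. Its first members are forced up to scaling:
  \<open>\<phi>\<^sub>j\<^sub>+\<^sub>1\<close> has to be a multiple of \<open>\<phi>\<^sub>j' - c\<^sub>j \<phi>\<^sub>j - b\<^sub>j \<phi>\<^sub>j\<^sub>-\<^sub>1\<close>, and computing this modulo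
  \<open>f\<^sup>3 + g\<^sup>3 = 2\<close> reveals the factor \<open>u\<close> gained every two steps.
\<close>
definition pf_ladder :: "nat \<Rightarrow> rat fps" where
  "pf_ladder j =
     (if even j then pf_egf else pf_egf_reflected ^ 2 - pf_egf)
     * (1 - pf_egf * pf_egf_reflected) ^ (j div 2)"

lemma pf_ladder_nth_0: "fps_nth (pf_ladder j) 0 = (if j = 0 then 1 else 0)"
proof (cases "j = 0")
  case False
  then have "odd j \<or> j div 2 > 0" by presburger
  then show ?thesis
    using False by (auto simp: pf_ladder_def pf_egf_nth_0 fps_power_zeroth)
qed (simp add: pf_ladder_def pf_egf_nth_0)

text \<open>
  Since \<open>f'\<close> and \<open>v'\<close> are combinations of \<open>f\<close>, \<open>v\<close> and \<open>f u\<close>, only the products \<open>f u'\<close> and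
  \<open>v u'\<close> need the relation \<open>f\<^sup>3 + g\<^sup>3 = 2\<close>; it makes \<open>f u'\<close> a combination of \<open>v\<close>, \<open>f u\<close>, \<open>v u\<close>,
  and \<open>v u'\<close> one of \<open>f u\<close>, \<open>v u\<close>, \<open>f u\<^sup>2\<close>. These are the neighbours of \<open>f u\<close> and of \<open>v u\<close> in
  the sequence, and multiplying by \<open>u\<^sup>k\<^sup>-\<^sup>1\<close> moves them to the neighbours of \<open>f u\<^sup>k\<close> and \<open>v u\<^sup>k\<close>.
\<close>
lemma deriv_pf_ladder:
  "fps_deriv (pf_ladder j) =
      fps_const (of_nat j * (if even j then 1 else 3)) * pf_ladder (j - 1)
    + fps_const (pf_c j) * pf_ladder j + fps_const (- of_nat (Suc j)) * pf_ladder (Suc j)"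
proof -
  define f where "f = pf_egf"
  define g where "g = pf_egf_reflected"
  define u where "u = 1 - f * g"
  define v where "v = g ^ 2 - f"
  have df: "fps_deriv f = - (g ^ 2)" and dg: "fps_deriv g = f ^ 2" and cubes: "f ^ 3 + g ^ 3 = 2"
    by (simp_all add: f_def g_def deriv_pf_egf deriv_pf_egf_reflected pf_egf_cubes)
  have du: "fps_deriv u = g ^ 3 - f ^ 3"
    by (simp add: u_def df dg power2_eq_square power3_eq_cube)
  have dv: "fps_deriv v = v + 3 * f - 2 * f * u"
    by (simp add: v_def u_def df dg fps_deriv_power' algebra_simps power2_eq_square)
  have fu: "f * fps_deriv u = 2 * v - 2 * f * u - 2 * v * u"
  proof -
    have "f * fps_deriv u - (2 * v - 2 * f * u - 2 * v * u) = f * (2 - (f ^ 3 + g ^ 3))"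
      unfolding du by (simp add: u_def v_def algebra_simps power2_eq_square power3_eq_cube)
    then show ?thesis
      by (simp add: cubes)
  qed
  have gu: "g ^ 2 * fps_deriv u = 2 * v + 4 * f * u - 2 * f * u ^ 2"
  proof -
    have "g ^ 2 * fps_deriv u - (2 * v + 4 * f * u - 2 * f * u ^ 2) = g ^ 2 * (f ^ 3 + g ^ 3 - 2)"
      unfolding du by (simp add: u_def v_def algebra_simps power2_eq_square power3_eq_cube)
    then show ?thesis
      by (simp add: cubes)
  qed
  have "v * fps_deriv u = g ^ 2 * fps_deriv u - f * fps_deriv u"
    by (simp add: v_def algebra_simps)
  then have vu: "v * fps_deriv u = 6 * f * u + 2 * v * u - 2 * f * u ^ 2"
    unfolding gu fu by simp
  have deriv_power: "fps_deriv (u ^ Suc i) = of_nat (Suc i) * u ^ i * fps_deriv u" for i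
    by (simp only: fps_deriv_power' diff_Suc_1 ac_simps)
  show ?thesis
  proof (cases "even j")
    case True
    then obtain k where j: "j = 2 * k" ..
    have "fps_deriv (f * u ^ k) =
       of_nat (2 * k) * (v * u ^ (k - 1)) - of_nat (2 * k + 1) * (f * u ^ k)
       - of_nat (2 * k + 1) * (v * u ^ k)"
    proof (cases k)
      case (Suc i)
      have "fps_deriv (f * u ^ k) = fps_deriv f * u ^ k + of_nat k * u ^ i * (f * fps_deriv u)"
        unfolding Suc fps_deriv_mult deriv_power by (simp only: algebra_simps)
      also have "fps_deriv f = - v - f" by (simp add: df v_def)
      finally show ?thesis unfolding fu
        by (simp add: Suc algebra_simps)
    qed (simp add: df v_def)
    moreover have "fps_const (of_nat j * (if even j then 1 else 3)) * pf_ladder (j - 1)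
        = of_nat (2 * k) * (v * u ^ (k - 1))"
      by (cases k) (simp_all add: j pf_ladder_def f_def g_def u_def v_def flip: fps_of_nat)
    moreover have "pf_ladder j = f * u ^ k" "pf_ladder (Suc j) = v * u ^ k"
      by (simp_all add: j pf_ladder_def f_def g_def u_def v_def)
    moreover have "fps_const (pf_c j) = - of_nat (2 * k + 1)"
        "fps_const (- of_nat (Suc j)) = (- of_nat (2 * k + 1) :: rat fps)"
      by (simp_all add: j pf_c_parity flip: fps_of_nat)
    ultimately show ?thesis
      by (simp only: mult_minus_left diff_conv_add_uminus)
  next
    case False
    then obtain k where j: "j = 2 * k + 1" by (elim oddE)
    have "fps_deriv (v * u ^ k) =
       of_nat (3 * (2 * k + 1)) * (f * u ^ k) + of_nat (2 * k + 1) * (v * u ^ k)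
       - of_nat (2 * k + 2) * (f * u ^ (k + 1))"
    proof (cases k)
      case (Suc i)
      have "fps_deriv (v * u ^ k) = fps_deriv v * u ^ k + of_nat k * u ^ i * (v * fps_deriv u)"
        unfolding Suc fps_deriv_mult deriv_power by (simp only: algebra_simps)
      then show ?thesis unfolding vu dv
        by (simp add: Suc algebra_simps power2_eq_square)
    qed (simp add: dv algebra_simps)
    moreover have "fps_const (of_nat j * (if even j then 1 else 3)) =
        (of_nat (3 * (2 * k + 1)) :: rat fps)"
      by (simp add: j flip: fps_of_nat)
    moreover have "pf_ladder (j - 1) = f * u ^ k" "pf_ladder j = v * u ^ k"
        "pf_ladder (Suc j) = f * u ^ (k + 1)"
      by (simp_all add: j pf_ladder_def f_def g_def u_def v_def)
    moreover have "fps_const (pf_c j) = of_nat (2 * k + 1)"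
        "fps_const (- of_nat (Suc j)) = (- of_nat (2 * k + 2) :: rat fps)"
      by (simp_all add: j pf_c_parity flip: fps_of_nat)
    ultimately show ?thesis
      by (simp only: mult_minus_left diff_conv_add_uminus)
  qed
qed

theorem theorem5: "has_jfrac pf_ogf pf_c pf_a"
  unfolding pf_ogf_eq_laplace
proof -
  have "has_jfrac (fps_laplace (pf_ladder 0)) pf_c pf_a"
  proof (rule has_jfrac_of_tridiagonal_system[OF pf_ladder_nth_0 deriv_pf_ladder])
    show "pf_a (Suc j) = of_nat (Suc j) * (if even (Suc j) then 1 else 3) * - of_nat (Suc j)" for j
      by (simp add: pf_a_parity power2_eq_square algebra_simps)
  qed simp
  then show "has_jfrac (fps_laplace pf_egf) pf_c pf_a"
    by (simp add: pf_ladder_def)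
qed

end
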